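(* Let $\mathbb{F}$ be a field, let $n,t$ be positive integers, and let $S\subseteq\mathbb{F}^n$. If every subset $T\subseteq S$ with $|T|\le\binom{n+t}{n}$ is contained in the union of $t$ affine hyperplanes of $\mathbb{F}^n$, then $S$ is contained in the union of $t$ affine hyperplanes of $\mathbb{F}^n$.
   Context: An affine hyperplane of $\mathbb{F}^n$ is an affine subspace of dimension $n-1$. "Contained in the union of $t$ affine hyperplanes" means that there exist affine hyperplanes $H_1,\dots,H_t$ (not required to be distinct) whose union contains the set. *)

theory Defs
  imports "HOL-Analysis.Cartesian_Space"
begin

text \<open>
  The library's \<open>affine\<close> and \<open>aff_dim\<close> are restricted to real vector spaces, so affine subspaces
  over an arbitrary field are defined here as translates of linear subspaces, whose dimension is
  the dimension of the direction space.
\<close>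

definition affine_subspace_of_dim :: "nat \<Rightarrow> ('a::field ^ 'n) set \<Rightarrow> bool" where
  "affine_subspace_of_dim d A \<longleftrightarrow>
     (\<exists>a W. vec.subspace W \<and> vec.dim W = d \<and> A = (\<lambda>w. a + w) ` W)"

definition affine_hyperplane :: "('a::field ^ 'n) set \<Rightarrow> bool" where
  "affine_hyperplane H \<longleftrightarrow> affine_subspace_of_dim (CARD('n) - 1) H"

definition covered_by_hyperplanes :: "nat \<Rightarrow> ('a::field ^ 'n) set \<Rightarrow> bool" where
  "covered_by_hyperplanes t T \<longleftrightarrow>
     (\<exists>H :: nat \<Rightarrow> ('a ^ 'n) set. (\<forall>i\<in>{1..t}. affine_hyperplane (H i)) \<and> T \<subseteq> (\<Union>i\<in>{1..t}. H i))"

end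

theory Submission
  imports Defs "HOL-Library.Multiset"
begin

text \<open>
  A union of \<open>t\<close> hyperplanes is the zero set of a product of \<open>t\<close> affine forms, and such a product lies
  in the span of the monomials of degree at most \<open>t\<close>, of which there are \<open>(n + t) choose n\<close>. Evaluation
  at the points of \<open>S\<close> spans a space of at most that dimension, so \<open>S\<close> has a subset \<open>T\<close> of at most
  that size such that every polynomial of degree at most \<open>t\<close> vanishing on \<open>T\<close> vanishes on \<open>S\<close>. Hence
  any \<open>t\<close> hyperplanes covering \<open>T\<close> already cover \<open>S\<close>.
\<close>

text \<open>Gaussian elimination, by induction on \<open>card M\<close>: a point \<open>s0\<close>
  at which some \<open>f m0\<close> is nonzero serves as pivot; it adds one point to
  \<open>T\<close> and removes one function.\<close>

lemma exists_finite_determining_subset: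
  fixes f :: "'m \<Rightarrow> 'x \<Rightarrow> 'a::field"
  assumes "finite M"
  shows "\<exists>T\<subseteq>S. finite T \<and> card T \<le> card M \<and>
           (\<forall>c. (\<forall>x\<in>T. (\<Sum>m\<in>M. c m * f m x) = 0) \<longrightarrow> (\<forall>x\<in>S. (\<Sum>m\<in>M. c m * f m x) = 0))"
  using assms
proof (induction "card M" arbitrary: M f)
  case 0
  then show ?case by (intro exI[of _ "{}"]) auto
next
  case (Suc k)
  show ?case
  proof (cases "\<exists>m\<in>M. \<exists>s\<in>S. f m s \<noteq> 0")
    case False
    then show ?thesis by (intro exI[of _ "{}"]) simp
  next
    case True
    then obtain m0 s0 where m0: "m0 \<in> M" "s0 \<in> S" and nz: "f m0 s0 \<noteq> 0" by blast
    \<comment> \<open>The multiple of the pivot function is chosen so that every \<open>g m\<close>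
      vanishes at \<open>s0\<close>.\<close>
    define g where "g m x = f m x - f m s0 / f m0 s0 * f m0 x" for m x
    define N where "N = M - {m0}"
    have N: "finite N" "k = card N"
      using Suc.hyps(2) Suc.prems m0 by (auto simp: N_def)
    obtain T where T: "T \<subseteq> S" "finite T" "card T \<le> card N"
      and det: "\<And>c. (\<forall>x\<in>T. (\<Sum>m\<in>N. c m * g m x) = 0) \<Longrightarrow> (\<forall>x\<in>S. (\<Sum>m\<in>N. c m * g m x) = 0)"
      using Suc.hyps(1)[OF N(2) N(1), of g] by blast
    \<comment> \<open>Vanishing at \<open>s0\<close> fixes \<open>c m0\<close> in terms of the other
      coefficients; substituting it leaves a combination of the \<open>g m\<close> with the
      remaining coefficients unchanged.\<close>
    have eliminate: "(\<Sum>m\<in>M. c m * f m x) = (\<Sum>m\<in>N. c m * g m x)"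
      if vanish: "(\<Sum>m\<in>M. c m * f m s0) = 0" for c x
    proof -
      have split: "(\<Sum>m\<in>M. c m * f m y) = c m0 * f m0 y + (\<Sum>m\<in>N. c m * f m y)" for y
        unfolding N_def using Suc.prems m0(1) by (rule sum.remove)
      have "(\<Sum>m\<in>N. c m * g m x) =
          (\<Sum>m\<in>N. c m * f m x) - (\<Sum>m\<in>N. c m * f m s0) / f m0 s0 * f m0 x"
        by (simp add: g_def sum_subtractf right_diff_distrib sum_distrib_right sum_divide_distrib
            mult.assoc)
      moreover have "(\<Sum>m\<in>N. c m * f m s0) = - (c m0 * f m0 s0)"
        using vanish split[of s0] by (simp add: eq_neg_iff_add_eq_0 add.commute)
      ultimately show ?thesis
        using split[of x] nz by simp
    qed
    show ?thesis
    proof (intro exI[of _ "insert s0 T"] conjI allI impI)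
      show "insert s0 T \<subseteq> S" "finite (insert s0 T)"
        using T m0 by auto
      show "card (insert s0 T) \<le> card M"
        using card_insert_le_m1[of "card M" T s0] T(3) N(2) Suc.hyps(2) by simp
      fix c assume "\<forall>x\<in>insert s0 T. (\<Sum>m\<in>M. c m * f m x) = 0"
      then show "\<forall>x\<in>S. (\<Sum>m\<in>M. c m * f m x) = 0"
        using eliminate[of c] det[of c] by simp
    qed
  qed
qed

text \<open>Induction on \<open>t\<close>: multiplying by one more linear form sends the monomial of
  \<open>X\<close> to those of \<open>add_mset j X\<close>. As \<open>c\<close> is chosen before
  \<open>y\<close>, the product is one fixed combination of monomials at all points.\<close>

lemma prod_linear_forms_eq_sum_monomials:
  fixes a :: "nat \<Rightarrow> 'j::finite \<Rightarrow> 'a::comm_semiring_1"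
  shows "\<exists>c. \<forall>y. (\<Prod>i=1..t. \<Sum>j\<in>UNIV. a i j * y j) =
           (\<Sum>X\<in>multisets_of_size UNIV t. c X * prod_mset (image_mset y X))"
proof (induction t)
  case 0
  show ?case by (intro exI[of _ "\<lambda>_. 1"]) simp
next
  case (Suc t)
  let ?M = "multisets_of_size (UNIV :: 'j set)"
  let ?mon = "\<lambda>(y :: 'j \<Rightarrow> 'a) X. prod_mset (image_mset y X)"
  obtain c where c: "\<And>y. (\<Prod>i=1..t. \<Sum>j\<in>UNIV. a i j * y j) = (\<Sum>X\<in>?M t. c X * ?mon y X)"
    using Suc.IH by blast
  \<comment> \<open>A multiset \<open>Y\<close> of size \<open>Suc t\<close> arises once for each
    distinct element \<open>j\<close> in it, so like terms are collected here.\<close>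
  define b where "b Y = (\<Sum>(X, j) | (X, j) \<in> ?M t \<times> UNIV \<and> add_mset j X = Y. c X * a (Suc t) j)" for Y
  have fin: "finite (?M k)" for k
    by (simp add: finite_multisets_of_size)
  have "(\<Prod>i=1..Suc t. \<Sum>j\<in>UNIV. a i j * y j) = (\<Sum>Y\<in>?M (Suc t). b Y * ?mon y Y)" for y
  proof -
    have "(\<Prod>i=1..Suc t. \<Sum>j\<in>UNIV. a i j * y j) =
        (\<Sum>X\<in>?M t. c X * ?mon y X) * (\<Sum>j\<in>UNIV. a (Suc t) j * y j)"
      unfolding c[symmetric] by (simp add: mult.commute)
    also have "\<dots> = (\<Sum>(X, j)\<in>?M t \<times> UNIV. c X * a (Suc t) j * ?mon y (add_mset j X))"
      unfolding sum_product sum.cartesian_product by (intro sum.cong refl) (auto simp: mult_ac)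
    also have "\<dots> = (\<Sum>Y\<in>?M (Suc t). \<Sum>p | p \<in> ?M t \<times> UNIV \<and> (\<lambda>(X, j). add_mset j X) p = Y.
        (\<lambda>(X, j). c X * a (Suc t) j * ?mon y (add_mset j X)) p)"
      by (intro sum.group[symmetric] finite_cartesian_product fin finite) (auto simp: multisets_of_size_def)
    also have "\<dots> = (\<Sum>Y\<in>?M (Suc t). b Y * ?mon y Y)"
      unfolding b_def sum_distrib_right
      by (intro sum.cong refl) (auto simp: split_beta)
    finally show ?thesis .
  qed
  then show ?case by blast
qed

text \<open>Extending a basis \<open>B\<close> of \<open>W\<close> to a basis \<open>B'\<close> of
  the whole space adds exactly one vector \<open>v\<close>; the coordinate along \<open>v\<close> is
  a linear functional with kernel \<open>W\<close>.\<close>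

lemma subspace_codim_one_eq_kernel:
  fixes W :: "('a::field ^ 'n) set"
  assumes "vec.subspace W" "vec.dim W = CARD('n) - 1"
  obtains a where "W = {x. (\<Sum>j\<in>UNIV. a j * x $ j) = 0}"
proof -
  obtain B where B: "B \<subseteq> W" "vec.independent B" "W \<subseteq> vec.span B" "card B = vec.dim W"
    using vec.basis_exists by blast
  obtain B' where B': "B \<subseteq> B'" "vec.independent B'" "UNIV \<subseteq> vec.span B'"
    by (rule vec.maximal_independent_subset_extend[OF subset_UNIV B(2)])
  have W: "W = vec.span B"
    using B assms(1) vec.span_minimal by blast
  have fin: "finite B'" "finite B"
    using B B' vec.finiteI_independent by blast+
  have span: "v \<in> vec.span B'" for v
    using B' by auto
  have "card B' = CARD('n)"
    using vec.dim_eq_card[of B' UNIV] B' vec_dim_card[where 'a='a and 'n='n]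
    by (auto simp: top_unique)
  then have "card (B' - B) = 1"
    using B' B fin assms(2) by (simp add: card_Diff_subset)
  then obtain v where v: "B' - B = {v}"
    by (auto simp: card_1_singleton_iff)
  let ?f = "\<lambda>x. vec.representation B' x v"
  interpret f: Vector_Spaces.linear "(*s)" "(*)" ?f
    using B' by (intro vec.linear_representation) auto
  \<comment> \<open>The coefficients of the functional are its values on the standard basis
    vectors.\<close>
  have f_eq: "?f x = (\<Sum>j\<in>UNIV. ?f (axis j 1) * x $ j)" for x
  proof -
    have "?f x = ?f (\<Sum>j\<in>UNIV. x $ j *s axis j 1)"
      by (simp add: basis_expansion)
    then show ?thesis
      by (simp add: f.sum f.scale mult.commute del: basis_expansion)
  qed
  have "x \<in> W \<longleftrightarrow> ?f x = 0" for x
  proof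
    assume "x \<in> W"
    then have "vec.representation B' x = vec.representation B x"
      using vec.representation_extend B' W by blast
    then show "?f x = 0"
      using v vec.representation_ne_zero[of B x v] by auto
  next
    assume "?f x = 0"
    have B'_eq: "B' = insert v B" "v \<notin> B" using v B' by auto
    have "x = (\<Sum>b\<in>B'. vec.representation B' x b *s b)"
      using vec.sum_representation_eq[OF B'(2) span fin(1) order_refl] by simp
    also have "\<dots> = (\<Sum>b\<in>B. vec.representation B' x b *s b)"
      using B'_eq fin \<open>?f x = 0\<close> by simp
    also have "\<dots> \<in> vec.span B"
      by (intro vec.span_sum vec.span_scale vec.span_base)
    finally show "x \<in> W" using W by simp
  qed
  then have "W = {x. (\<Sum>j\<in>UNIV. ?f (axis j 1) * x $ j) = 0}"
    unfolding f_eq[symmetric] by blast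
  then show thesis by (rule that)
qed

text \<open>Adjoins a homogenizing coordinate, so that affine forms become linear forms.\<close>

definition homogenize :: "'a::field ^ 'n \<Rightarrow> 'n option \<Rightarrow> 'a" where
  "homogenize x = case_option 1 (($) x)"

lemma affine_hyperplane_eq_zero_set:
  fixes H :: "('a::field ^ 'n) set"
  assumes "affine_hyperplane H"
  shows "\<exists>a. H = {x. (\<Sum>j\<in>UNIV. a j * homogenize x j) = 0}"
proof -
  obtain p W where W: "vec.subspace W" "vec.dim W = CARD('n) - 1" "H = (\<lambda>w. p + w) ` W"
    using assms by (auto simp: affine_hyperplane_def affine_subspace_of_dim_def)
  obtain a where a: "W = {x. (\<Sum>j\<in>UNIV. a j * x $ j) = 0}"
    using subspace_codim_one_eq_kernel[OF W(1,2)] .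
  \<comment> \<open>The constant term, carried by \<open>None\<close>, makes the affine form vanish
    at \<open>p\<close>.\<close>
  define b where "b = case_option (- (\<Sum>j\<in>UNIV. a j * p $ j)) a"
  have "x \<in> H \<longleftrightarrow> (\<Sum>j\<in>UNIV. b j * homogenize x j) = 0" for x
  proof -
    have "x \<in> H \<longleftrightarrow> x - p \<in> W"
      by (force simp: W(3) image_iff)
    also have "\<dots> \<longleftrightarrow> (\<Sum>j\<in>UNIV. b j * homogenize x j) = 0"
      by (simp add: a b_def homogenize_def UNIV_option_conv sum.reindex right_diff_distrib
          sum_subtractf)
    finally show ?thesis .
  qed
  then show ?thesis by blast
qed

theorem theorem3:
  fixes S :: "('a::field ^ 'n) set" and t :: nat
  assumes "t > 0"
    and "\<And>T. T \<subseteq> S \<Longrightarrow> finite T \<Longrightarrow> card T \<le> (CARD('n) + t) choose CARD('n)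
           \<Longrightarrow> covered_by_hyperplanes t T"
  shows "covered_by_hyperplanes t S"
proof -
  let ?M = "multisets_of_size (UNIV :: 'n option set) t"
  let ?mon = "\<lambda>X (x :: 'a ^ 'n). prod_mset (image_mset (homogenize x) X)"
  have fin: "finite ?M"
    by (simp add: finite_multisets_of_size)
  \<comment> \<open>With the homogenizing coordinate there are \<open>CARD('n) + 1\<close>
    variables, so the multisets number \<open>(CARD('n) + t) choose t\<close>.\<close>
  have card: "card ?M = (CARD('n) + t) choose CARD('n)"
    using binomial_symmetric[of "CARD('n)" "CARD('n) + t"] by (simp add: card_multisets_of_size)
  obtain T where T: "T \<subseteq> S" "finite T" "card T \<le> card ?M"
    and det: "\<And>c. (\<forall>x\<in>T. (\<Sum>X\<in>?M. c X * ?mon X x) = 0) \<Longrightarrow> (\<forall>x\<in>S. (\<Sum>X\<in>?M. c X * ?mon X x) = 0)"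
    using exists_finite_determining_subset[OF fin, of S ?mon] by blast
  have "covered_by_hyperplanes t T"
    using assms(2) T card by simp
  then obtain H where H: "\<forall>i\<in>{1..t}. affine_hyperplane (H i)" "T \<subseteq> (\<Union>i\<in>{1..t}. H i)"
    unfolding covered_by_hyperplanes_def by blast
  have "\<forall>i\<in>{1..t}. \<exists>a. H i = {x. (\<Sum>j\<in>UNIV. a j * homogenize x j) = 0}"
    using H(1) affine_hyperplane_eq_zero_set by blast
  from bchoice[OF this] obtain a
    where a: "\<And>i. i \<in> {1..t} \<Longrightarrow> H i = {x. (\<Sum>j\<in>UNIV. a i j * homogenize x j) = 0}"
    by blast
  obtain c where c: "\<And>y. (\<Prod>i=1..t. \<Sum>j\<in>UNIV. a i j * y j) =
      (\<Sum>X\<in>?M. c X * prod_mset (image_mset y X))"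
    using prod_linear_forms_eq_sum_monomials[of a t] by blast
  \<comment> \<open>In a field a product is zero exactly when one of its factors is.\<close>
  have zero_set: "x \<in> (\<Union>i\<in>{1..t}. H i) \<longleftrightarrow> (\<Sum>X\<in>?M. c X * ?mon X x) = 0" for x
    unfolding c[symmetric] by (auto simp: a)
  have "S \<subseteq> (\<Union>i\<in>{1..t}. H i)"
    using det[of c] H(2) unfolding zero_set[symmetric] by blast
  then show ?thesis
    using H(1) unfolding covered_by_hyperplanes_def by blast
qed

end
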